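(* Let $n_0$ be a positive integer, let customers follow the pure threshold strategy with threshold $n_0$, and let the service policy $(\mu_k)_{k\ge1}$ have service rate non-decreasing in the number $k$ of customers in the system. Let $n$ be an integer with $1\le n\le n_0-1$, and consider the coupled systems $A$ and $B$ described in the context. Then, with probability $1$, $$T_A(j)\le T_B(j)\quad\text{for any } j=1,2,\dots,n.$$
   Context: Service policy: $0<\mu_1\le\mu_2\le\cdots$ with $\lim_{k\to\infty}\mu_k=M<\infty$; $\mu_k$ is the service rate when $k$ customers are in the system. Pure threshold strategy with threshold $n_0$: an arriving customer joins the system if and only if she finds at most $n_0-1$ customers present. Coupled systems. $A$ and $B$ are two single-server first-come-first-served queueing systems. At time $t=0$ system $A$ contains $n$ customers, labeled $1,\dots,n$ in order of service, with customer $1$ in service; system $B$ contains $n+1$ customers, labeled $0,1,\dots,n$ in order of service, with customer $0$ just starting service. Future customers $n+1,n+2,\dots$ arrive after time $0$ at the epochs of a Poisson process of rate $\lambda>0$, and these arrival epochs are the same in both systems. In each system an arrival joins if and only if the number of customers present in that system is less than $n_0$; otherwise she is lost to that system. The service requirements $S_0,S_1,\dots,S_n$ of customers $0,1,\dots,n$ are i.i.d. exponential random variables with mean $1$, independent of the arrival process. For $j=1,\dots,n$, the same requirement $S_j$ is used in both systems, and at $t=0$ it is entirely unserved. In each system, at any time $t$ at which $k$ customers are present, the remaining service requirement of the customer in service decreases at instantaneous rate $\mu_k$, and a customer departs when her requirement reaches $0$. $T_A(j)$ and $T_B(j)$ denote the sojourn times (departure times, measured from $t=0$) of customer $j$ in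 systems $A$ and $B$, respectively. *)

theory Defs
  imports "HOL-Probability.Probability"
begin

text \<open>
  A queue lists the customers present in order of service, each as a pair of a label and a remaining
  service requirement; the head is the customer in service.
\<close>

type_synonym queue = "(nat \<times> real) list"

text \<open>
  Evolution of a queue over a time span \<open>\<tau>\<close> without arrivals. While \<open>k\<close> customers are present the
  requirement of the head decreases at rate \<open>\<mu> k\<close>; \<open>k\<close> is constant until the head departs, which
  happens after time \<open>r / \<mu> k\<close>.
\<close>

fun serve :: "(nat \<Rightarrow> real) \<Rightarrow> real \<Rightarrow> queue \<Rightarrow> queue" where
  "serve \<mu> \<tau> [] = []"
| "serve \<mu> \<tau> ((j, r) # q) =
     (let k = Suc (length q) in
      if r \<le> \<mu> k * \<tau> then serve \<mu> (\<tau> - r / \<mu> k) q else (j, r - \<mu> k * \<tau>) # q)"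

definition threshold_join :: "nat \<Rightarrow> nat \<times> real \<Rightarrow> queue \<Rightarrow> queue" where
  "threshold_join n0 c q = (if length q < n0 then q @ [c] else q)"

text \<open>
  The future arrivals are numbered from 0: \<open>a i\<close> is the epoch of arrival \<open>i\<close>, and \<open>last_epoch a k\<close> is
  the epoch of the last of the first \<open>k\<close> arrivals, or time 0 if \<open>k = 0\<close>.
\<close>

definition last_epoch :: "(nat \<Rightarrow> real) \<Rightarrow> nat \<Rightarrow> real" where
  "last_epoch a k = (case k of 0 \<Rightarrow> 0 | Suc i \<Rightarrow> a i)"

text \<open>
  The queue just after the first \<open>k\<close> arrivals, when it is \<open>q0\<close> at time 0 and \<open>c i\<close> is the \<open>i\<close>-th
  arriving customer (label and requirement). A departure at the very epoch of an arrival, which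
  has probability 0, counts as preceding it.
\<close>

primrec queue_after ::
  "(nat \<Rightarrow> real) \<Rightarrow> nat \<Rightarrow> queue \<Rightarrow> (nat \<Rightarrow> real) \<Rightarrow> (nat \<Rightarrow> nat \<times> real) \<Rightarrow> nat \<Rightarrow> queue" where
  "queue_after \<mu> n0 q0 a c 0 = q0"
| "queue_after \<mu> n0 q0 a c (Suc k) =
     threshold_join n0 (c k) (serve \<mu> (a k - last_epoch a k) (queue_after \<mu> n0 q0 a c k))"

definition queue_at ::
  "(nat \<Rightarrow> real) \<Rightarrow> nat \<Rightarrow> queue \<Rightarrow> (nat \<Rightarrow> real) \<Rightarrow> (nat \<Rightarrow> nat \<times> real) \<Rightarrow> real \<Rightarrow> queue" where
  "queue_at \<mu> n0 q0 a c t =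
     (let k = card {i. a i \<le> t} in serve \<mu> (t - last_epoch a k) (queue_after \<mu> n0 q0 a c k))"

text \<open>
  Departure time of a customer \<open>j\<close> who is present at time 0. It is extended-real valued, so that it
  is \<open>\<infinity>\<close>, the infimum of the empty set, on a path on which \<open>j\<close> never departs.
\<close>

definition departure_time ::
  "(nat \<Rightarrow> real) \<Rightarrow> nat \<Rightarrow> queue \<Rightarrow> (nat \<Rightarrow> real) \<Rightarrow> (nat \<Rightarrow> nat \<times> real) \<Rightarrow> nat \<Rightarrow> ereal" where
  "departure_time \<mu> n0 q0 a c j =
     Inf (ereal ` {t. 0 \<le> t \<and> j \<notin> fst ` set (queue_at \<mu> n0 q0 a c t)})"

text \<open>
  Here \<open>s j\<close> is the requirement of customer \<open>j \<le> n\<close>, and \<open>v i\<close> that of the future customer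
  \<open>n + 1 + i\<close>, who arrives at epoch \<open>a i\<close>.
\<close>

definition T_A ::
  "(nat \<Rightarrow> real) \<Rightarrow> nat \<Rightarrow> nat \<Rightarrow> (nat \<Rightarrow> real) \<Rightarrow> (nat \<Rightarrow> real) \<Rightarrow> (nat \<Rightarrow> real) \<Rightarrow> nat \<Rightarrow> ereal" where
  "T_A \<mu> n0 n a s v =
     departure_time \<mu> n0 (map (\<lambda>j. (j, s j)) [1..<n + 1]) a (\<lambda>i. (n + 1 + i, v i))"

definition T_B ::
  "(nat \<Rightarrow> real) \<Rightarrow> nat \<Rightarrow> nat \<Rightarrow> (nat \<Rightarrow> real) \<Rightarrow> (nat \<Rightarrow> real) \<Rightarrow> (nat \<Rightarrow> real) \<Rightarrow> nat \<Rightarrow> ereal" where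
  "T_B \<mu> n0 n a s v =
     departure_time \<mu> n0 (map (\<lambda>j. (j, s j)) [0..<n + 1]) a (\<lambda>i. (n + 1 + i, v i))"

text \<open>
  The epochs of a Poisson process on the positive half-line, characterised by i.i.d. exponential
  interarrival times.
\<close>

definition poisson_epochs :: "'w measure \<Rightarrow> real \<Rightarrow> (nat \<Rightarrow> 'w \<Rightarrow> real) \<Rightarrow> bool" where
  "poisson_epochs M l a \<longleftrightarrow>
     prob_space.indep_vars M (\<lambda>_. borel) (\<lambda>k \<omega>. a k \<omega> - last_epoch (\<lambda>i. a i \<omega>) k) UNIV \<and>
     (\<forall>k. distributed M lborel (\<lambda>\<omega>. a k \<omega> - last_epoch (\<lambda>i. a i \<omega>) k) (exponential_density l))"

end

theory Submission
  imports Defs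
begin

text \<open>
  The comparison holds on every path with nonnegative requirements and interarrival times. As long
  as some of the customers \<open>1, \<dots>, n\<close> are present in \<open>A\<close>, two things persist: \<open>A\<close> is ahead of \<open>B\<close> in
  serving these customers, and \<open>A\<close> has admitted at least as many later arrivals as \<open>B\<close>. Being ahead
  keeps the number of initial customers in \<open>A\<close> at most that in \<open>B\<close>, so when both systems have
  admitted equally many arrivals and \<open>B\<close> admits the next one, so does \<open>A\<close>. Conversely, \<open>B\<close> can overtake only at a
  moment when both systems have the same initial customers left, but then \<open>A\<close> holds at
  least as many customers in total and therefore serves at least as fast.
\<close>

text \<open>
  In \<open>running\<close>, customer \<open>i\<close> is in service in \<open>A\<close>, \<open>D\<close> holds the customers still before her in \<open>B\<close>,
  \<open>Q\<close> the tracked customers behind her, and \<open>E\<close>, \<open>F\<close> the later arrivals admitted to \<open>A\<close> and \<open>B\<close>.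
  Zero requirements are allowed, so that the relation persists at the very instants of departures.
\<close>

inductive ahead :: "nat set \<Rightarrow> queue \<Rightarrow> queue \<Rightarrow> bool" for L where
  finished: "fst ` set A \<inter> L = {} \<Longrightarrow> ahead L A B"
| running: "0 \<le> r \<Longrightarrow> r \<le> r' \<Longrightarrow> \<forall>x\<in>set (D @ Q). 0 \<le> snd x \<Longrightarrow> length F \<le> length E \<Longrightarrow>
    fst ` set E \<inter> L = {} \<Longrightarrow> ahead L ((i, r) # Q @ E) (D @ (i, r') # Q @ F)"

lemma ahead_labels:
  assumes "ahead L A B" "j \<in> L" "j \<notin> fst ` set B"
  shows "j \<notin> fst ` set A"
  using assms by cases auto

text \<open>An admission to \<open>B\<close> alone is harmless while \<open>F\<close> is strictly
  shorter than \<open>E\<close>; if they are equally long, \<open>A\<close> is no longer than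
  \<open>B\<close> and admits too. Joining depends on lengths only, so \<open>c\<close> and
  \<open>d\<close> may differ.\<close>

lemma ahead_threshold_join:
  assumes "ahead L A B" "fst c \<notin> L"
  shows "ahead L (threshold_join n0 c A) (threshold_join n0 d B)"
  using assms
proof cases
  case finished
  with assms(2) show ?thesis
    by (intro ahead.finished) (auto simp: threshold_join_def)
next
  case (running r r' D Q F E i)
  define E' where "E' = (if length A < n0 then E @ [c] else E)"
  define F' where "F' = (if length B < n0 then F @ [d] else F)"
  have "ahead L ((i, r) # Q @ E') (D @ (i, r') # Q @ F')"
    using running assms(2) by (intro ahead.running) (auto simp: E'_def F'_def)
  moreover have "threshold_join n0 c A = (i, r) # Q @ E'" "threshold_join n0 d B = D @ (i, r') # Q @ F'"
    using running by (auto simp: threshold_join_def E'_def F'_def)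
  ultimately show ?thesis by simp
qed

lemma labels_serve: "fst ` set (serve \<mu> \<tau> q) \<subseteq> fst ` set q"
  by (induction \<mu> \<tau> q rule: serve.induct) (auto simp: Let_def)

lemma ahead_serve_finished:
  assumes "fst ` set A \<inter> L = {}"
  shows "ahead L (serve \<mu> \<tau> A) B"
  using assms labels_serve[of \<mu> \<tau> A] by (intro ahead.finished) blast

lemma last_epoch_card_le:
  assumes "\<And>k. last_epoch a k \<le> a k" "0 \<le> t"
  shows "last_epoch a (card {i. a i \<le> t}) \<le> t"
proof (cases "card {i. a i \<le> t}")
  \<comment> \<open>An infinite set of epochs also falls under this case, its \<open>card\<close>
    being 0.\<close>
  case 0
  then show ?thesis using assms(2) by (simp add: last_epoch_def)
next
  case (Suc m)
  have "incseq a"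
    using assms(1)[of "Suc _"] by (intro incseq_SucI) (simp add: last_epoch_def)
  have "a m \<le> t"
  proof (rule ccontr)
    assume "\<not> a m \<le> t"
    then have "{i. a i \<le> t} \<subseteq> {..<m}"
      using incseqD[OF \<open>incseq a\<close>] by (force simp: not_le[symmetric])
    then have "card {i. a i \<le> t} \<le> m"
      using card_mono[of "{..<m}"] by simp
    with Suc show False by simp
  qed
  then show ?thesis by (simp add: Suc last_epoch_def)
qed

locale nondecreasing_policy =
  fixes \<mu> :: "nat \<Rightarrow> real"
  assumes rate_1_pos: "0 < \<mu> 1"
    and rate_Suc: "1 \<le> k \<Longrightarrow> \<mu> k \<le> \<mu> (Suc k)"
begin

lemma rate_mono:
  assumes "1 \<le> k" "k \<le> m"
  shows "\<mu> k \<le> \<mu> m"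
  using assms(2)
proof (induction m rule: dec_induct)
  case (step m)
  then show ?case using rate_Suc[of m] assms(1) by simp
qed simp

lemma rate_pos: "1 \<le> k \<Longrightarrow> 0 < \<mu> k"
  using rate_mono[of 1 k] rate_1_pos by simp

text \<open>Work done on the head in advance leaves its departure epoch unchanged. This lets one
  system be cut at a departure epoch of the other.\<close>

lemma serve_shift:
  assumes "k = Suc (length q)"
  shows "serve \<mu> \<tau> ((j, r) # q) = serve \<mu> (\<tau> - \<delta>) ((j, r - \<mu> k * \<delta>) # q)"
proof -
  have "\<mu> k > 0" using assms by (simp add: rate_pos)
  then have "\<tau> - \<delta> - (r - \<mu> k * \<delta>) / \<mu> k = \<tau> - r / \<mu> k"
    by (simp add: field_simps)
  then show ?thesis
    by (simp add: assms algebra_simps)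
qed

lemma serve_depart:
  assumes "r \<le> \<mu> (Suc (length q)) * \<tau>"
  shows "serve \<mu> \<tau> ((j, r) # q) = serve \<mu> (\<tau> - r / \<mu> (Suc (length q))) q"
  using assms by simp

text \<open>Rates are constant until the first departure in either system. Jumping to that epoch
  removes a customer, whence the induction on the total number present.\<close>

lemma ahead_serve:
  assumes "ahead L A B" "0 \<le> \<tau>"
  shows "ahead L (serve \<mu> \<tau> A) (serve \<mu> \<tau> B)"
  using assms
proof (induction "length A + length B" arbitrary: A B \<tau> rule: less_induct)
  case less
  from less.prems(1) show ?case
  proof cases
    case finished
    then show ?thesis by (rule ahead_serve_finished)
  next
    case (running r r' D Q F E i)
    have "B \<noteq> []"
      using running by simp
    then obtain x s B' where B: "B = (x, s) # B'"
      by (metis list.exhaust surj_pair)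
    define a where "a = \<mu> (length A)"
    define b where "b = \<mu> (length B)"
    have pos: "0 < a" "0 < b"
      using running B by (auto simp: a_def b_def intro!: rate_pos)
    have s: "0 \<le> s"
      using running B by (cases D) auto
    have len: "length A = Suc (length (Q @ E))" "length B = Suc (length B')"
      using running(1) B by auto
    have slower: "b \<le> a \<and> r \<le> s" if "D = []"
      using that running B by (auto simp: a_def b_def intro!: rate_mono)
    \<comment> \<open>Work on the head of \<open>B\<close> keeps the shape required by
      \<open>running\<close>; it reaches customer \<open>i\<close> only when \<open>D\<close> is
      empty.\<close>
    have head: "\<exists>D' t. (x, s - d) # B' = D' @ (i, t) # Q @ F \<and> (\<forall>y\<in>set D'. 0 \<le> snd y) \<and>
        length D' = length D \<and> (D \<noteq> [] \<longrightarrow> t = r') \<and> (D = [] \<longrightarrow> D' = [] \<and> t = r' - d \<and> s = r')"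
      if "d \<le> s" for d
    proof (cases D)
      case Nil
      then show ?thesis using B running by auto
    next
      case (Cons y D')
      then show ?thesis using B running that
        by (intro exI[of _ "(x, s - d) # D'"] exI[of _ r']) auto
    qed
    \<comment> \<open>The heads are due to depart at \<open>r / a\<close> and \<open>s / b\<close>,
      compared here after multiplying out; ties go to \<open>A\<close>.\<close>
    consider (none) "a * \<tau> < r" "b * \<tau> < s"
      | (A) "r \<le> a * \<tau>" "b * r \<le> a * s"
      | (B) "s \<le> b * \<tau>" "a * s < b * r"
    proof -
      have "s \<le> b * \<tau>" if "a * s < b * r" "r \<le> a * \<tau>"
      proof -
        have "a * s < b * (a * \<tau>)"
          using that(1) mult_left_mono[OF that(2), of b] pos by linarith
        then show ?thesis using pos by (simp add: mult.left_commute[of b])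
      qed
      moreover have "r \<le> a * \<tau>" if "b * r \<le> a * s" "s \<le> b * \<tau>"
      proof -
        have "b * r \<le> a * (b * \<tau>)"
          using that(1) mult_left_mono[OF that(2), of a] pos by linarith
        then show ?thesis using pos by (simp add: mult.left_commute[of a])
      qed
      ultimately show thesis using that by fastforce
    qed
    then show ?thesis
    proof cases
      case none
      have serve: "serve \<mu> \<tau> A = (i, r - a * \<tau>) # Q @ E" "serve \<mu> \<tau> B = (x, s - b * \<tau>) # B'"
        using none running(1) B len by (simp_all add: a_def b_def)
      obtain D' t where D': "(x, s - b * \<tau>) # B' = D' @ (i, t) # Q @ F"
        "\<forall>y\<in>set D'. 0 \<le> snd y" "D \<noteq> [] \<longrightarrow> t = r'" "D = [] \<longrightarrow> t = r' - b * \<tau>"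
        using head[of "b * \<tau>"] none by auto
      have "0 \<le> a * \<tau>" using pos less.prems(2) by simp
      moreover have "b * \<tau> \<le> a * \<tau>" if "D = []"
        using slower[OF that] less.prems(2) by (simp add: mult_right_mono)
      ultimately have "r - a * \<tau> \<le> t"
        using D'(3,4) running by (cases "D = []") auto
      then show ?thesis
        unfolding serve D'(1) using none running D'(2) by (intro ahead.running) auto
    next
      case A
      define \<delta> where "\<delta> = r / a"
      have \<delta>: "\<delta> \<le> \<tau>" "b * \<delta> \<le> s" "0 \<le> b * \<delta>"
        using A pos running by (auto simp: \<delta>_def field_simps)
      have serveA: "serve \<mu> \<tau> A = serve \<mu> (\<tau> - \<delta>) (Q @ E)"
        using serve_depart[of r "Q @ E" \<tau> i] A running(1) len by (simp add: a_def \<delta>_def)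
      have serveB: "serve \<mu> \<tau> B = serve \<mu> (\<tau> - \<delta>) ((x, s - b * \<delta>) # B')"
        unfolding B b_def by (rule serve_shift) simp
      show ?thesis
      proof (cases Q)
        case Nil
        then show ?thesis
          unfolding serveA using running by (intro ahead_serve_finished) simp
      next
        \<comment> \<open>Customer \<open>i\<close> has left \<open>A\<close> but is still listed in
          \<open>B\<close>, possibly with requirement 0 after a tie, so she moves to the end of the
          new \<open>D\<close>.\<close>
        case (Cons y Q')
        obtain D' t where D': "(x, s - b * \<delta>) # B' = D' @ (i, t) # Q @ F"
          "\<forall>z\<in>set D'. 0 \<le> snd z" "D \<noteq> [] \<longrightarrow> t = r'" "D = [] \<longrightarrow> t = s - b * \<delta>"
          using head[of "b * \<delta>"] \<delta> by auto
        have "0 \<le> t"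
          using D'(3,4) \<delta> running by (cases "D = []") auto
        then have "ahead L ((fst y, snd y) # Q' @ E) ((D' @ [(i, t)]) @ (fst y, snd y) # Q' @ F)"
          using running Cons D'(2) by (intro ahead.running) auto
        then have "ahead L (Q @ E) ((x, s - b * \<delta>) # B')"
          using Cons D'(1) by simp
        then show ?thesis
          unfolding serveA serveB using \<delta> len B by (intro less.hyps) auto
      qed
    next
      case B': B
      define \<delta> where "\<delta> = s / b"
      have \<delta>: "\<delta> \<le> \<tau>" "0 \<le> r - a * \<delta>" "0 \<le> a * \<delta>"
        using B' pos s by (auto simp: \<delta>_def field_simps)
      \<comment> \<open>Otherwise both heads are customer \<open>i\<close>, and \<open>A\<close>,
        with no more work left and no lower rate, would finish her no later than
        \<open>B\<close>.\<close>
      have "D \<noteq> []"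
      proof
        assume "D = []"
        then have "b * r \<le> a * s"
          using slower pos running by (intro mult_mono) auto
        with B' show False by simp
      qed
      then obtain D' where D': "D = (x, s) # D'"
        using running B by (cases D) auto
      have serveA: "serve \<mu> \<tau> A = serve \<mu> (\<tau> - \<delta>) ((i, r - a * \<delta>) # Q @ E)"
        unfolding running(1) a_def by (rule serve_shift) simp
      have serveB: "serve \<mu> \<tau> B = serve \<mu> (\<tau> - \<delta>) B'"
        using serve_depart[of s B' \<tau> x] B' B len by (simp add: b_def \<delta>_def)
      have "ahead L ((i, r - a * \<delta>) # Q @ E) (D' @ (i, r') # Q @ F)"
        using running D' \<delta> by (intro ahead.running) auto
      moreover have "B' = D' @ (i, r') # Q @ F"
        using B running D' by simp
      ultimately have "ahead L ((i, r - a * \<delta>) # Q @ E) B'"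
        by simp
      then show ?thesis
        unfolding serveA serveB using \<delta> len B by (intro less.hyps) auto
    qed
  qed
qed

lemma ahead_queue_after:
  assumes "ahead L A B" "\<And>k. last_epoch a k \<le> a k" "\<And>k. fst (c k) \<notin> L"
  shows "ahead L (queue_after \<mu> n0 A a c k) (queue_after \<mu> n0 B a d k)"
  using assms by (induction k) (auto intro!: ahead_threshold_join ahead_serve)

lemma departure_time_mono:
  assumes "ahead L A B" "\<And>k. last_epoch a k \<le> a k" "\<And>k. fst (c k) \<notin> L" "j \<in> L"
  shows "departure_time \<mu> n0 A a c j \<le> departure_time \<mu> n0 B a d j"
proof -
  have "ahead L (queue_at \<mu> n0 A a c t) (queue_at \<mu> n0 B a d t)" if "0 \<le> t" for t
    using assms last_epoch_card_le[of a t] that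
    by (auto simp: queue_at_def Let_def intro!: ahead_serve ahead_queue_after)
  then show ?thesis
    unfolding departure_time_def
    by (intro Inf_superset_mono image_mono Collect_mono) (metis ahead_labels assms(4))
qed

text \<open>At time 0, \<open>D\<close> is customer 0 alone and \<open>E\<close>, \<open>F\<close>
  are empty. The requirements \<open>v\<close> and \<open>w\<close> of later arrivals may differ,
  since first-come-first-served order puts them behind all of \<open>1, ..., n\<close>.\<close>

lemma T_A_le_T_B:
  assumes "\<And>k. last_epoch a k \<le> a k" "\<And>i. i \<le> n \<Longrightarrow> 0 \<le> s i" "j \<in> {1..n}"
  shows "T_A \<mu> n0 n a s v j \<le> T_B \<mu> n0 n a s w j"
proof -
  define Q where "Q = map (\<lambda>j. (j, s j)) [2..<n + 1]"
  have split: "[1..<n + 1] = 1 # [2..<n + 1]" "[0..<n + 1] = 0 # 1 # [2..<n + 1]"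
    using assms(3) by (auto simp: upt_rec numeral_2_eq_2)
  have "ahead {1..n} ((1, s 1) # Q @ []) ([(0, s 0)] @ (1, s 1) # Q @ [])"
    using assms(2,3) by (intro ahead.running) (auto simp: Q_def)
  then have "ahead {1..n} (map (\<lambda>j. (j, s j)) [1..<n + 1]) (map (\<lambda>j. (j, s j)) [0..<n + 1])"
    unfolding split by (simp add: Q_def)
  then show ?thesis
    unfolding T_A_def T_B_def using assms(1,3) by (intro departure_time_mono) auto
qed

end

lemma (in prob_space) AE_exponential_nonneg:
  assumes "distributed M lborel X (exponential_density l)"
  shows "AE \<omega> in M. 0 \<le> X \<omega>"
  by (subst distributed_AE2[OF assms]) (auto simp: exponential_density_def)

theorem proposition1:
  fixes M :: "'w measure"
    and \<mu> :: "nat \<Rightarrow> real" and \<mu>_lim :: real and l :: real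
    and n0 n :: nat
    and a :: "nat \<Rightarrow> 'w \<Rightarrow> real"
    and S :: "nat \<Rightarrow> 'w \<Rightarrow> real"
    and V_A V_B :: "nat \<Rightarrow> 'w \<Rightarrow> real"
  assumes "prob_space M"
    and "0 < \<mu> 1"
    and "\<And>k. 1 \<le> k \<Longrightarrow> \<mu> k \<le> \<mu> (Suc k)"
    and "\<mu> \<longlonglongrightarrow> \<mu>_lim"
    and "1 \<le> n0" and "1 \<le> n" and "n \<le> n0 - 1"
    and "0 < l"
    and "poisson_epochs M l a"
    and "prob_space.indep_vars M (\<lambda>_. borel) S {0..n}"
    and "\<And>j. j \<le> n \<Longrightarrow> distributed M lborel (S j) (exponential_density 1)"
    and "prob_space.indep_var M
           (\<Pi>\<^sub>M j\<in>{0..n}. borel) (\<lambda>\<omega>. \<lambda>j\<in>{0..n}. S j \<omega>)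
           (\<Pi>\<^sub>M k\<in>UNIV. borel) (\<lambda>\<omega> k. a k \<omega>)"
  shows "AE \<omega> in M. \<forall>j\<in>{1..n}.
           T_A \<mu> n0 n (\<lambda>k. a k \<omega>) (\<lambda>i. S i \<omega>) (\<lambda>i. V_A i \<omega>) j
           \<le> T_B \<mu> n0 n (\<lambda>k. a k \<omega>) (\<lambda>i. S i \<omega>) (\<lambda>i. V_B i \<omega>) j"
proof -
  interpret prob_space M by fact
  interpret nondecreasing_policy \<mu>
    using assms(2,3) by unfold_locales
  have "AE \<omega> in M. 0 \<le> a k \<omega> - last_epoch (\<lambda>i. a i \<omega>) k" for k
    using assms(9) by (intro AE_exponential_nonneg) (auto simp: poisson_epochs_def)
  then have "AE \<omega> in M. \<forall>k. 0 \<le> a k \<omega> - last_epoch (\<lambda>i. a i \<omega>) k"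
    by (simp add: AE_all_countable)
  moreover have "AE \<omega> in M. \<forall>i\<in>{..n}. 0 \<le> S i \<omega>"
    using assms(11) by (intro AE_finite_allI) (auto intro: AE_exponential_nonneg)
  ultimately show ?thesis
    by eventually_elim (auto intro!: T_A_le_T_B)
qed

end
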